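(* One has the disjoint union $\mathcal{P}_5=\mathcal{P}_{5,1}\sqcup\mathcal{P}_{5,3}$, and $$\mathcal{P}_5=\{s_3x^3+s_2x^2+s_1x+s_0\colon s_0,s_1,s_2,s_3\in\mathbb{F}_5,\ (s_1+s_3)^4=1,\ s_2^2=3s_1s_3\},$$ with $$\mathcal{P}_{5,1}=\{s_1x+s_0\colon s_0,s_1\in\mathbb{F}_5,\ s_1^4=1\}$$ and $$\mathcal{P}_{5,3}=\{s_3x^3+s_2x^2+s_1x+s_0\colon s_0,s_1,s_2,s_3\in\mathbb{F}_5,\ s_3^4=1,\ s_2^2=3s_1s_3\}.$$
   Context: $\mathbb{F}_5$ is the field with five elements. $\mathcal{P}_5$ is the set of polynomials in $\mathbb{F}_5[x]$ of degree less than $5$ that act as permutations of $\mathbb{F}_5$, and $\mathcal{P}_{5,d}$ is the subset of those of degree $d$. *)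

theory Defs
  imports "HOL-Computational_Algebra.Polynomial" "HOL-Library.Cardinality"
begin

text \<open>
  The field with five elements is represented by an arbitrary type of class \<open>field\<close> having
  exactly five elements; this cardinality is a hypothesis of the theorem, not of the definitions.
\<close>

definition perm_polys5 :: "'a::field poly set" where
  "perm_polys5 = {f. degree f < 5 \<and> bij (poly f)}"

definition perm_polys5_deg :: "nat \<Rightarrow> 'a::field poly set" where
  "perm_polys5_deg d = {f \<in> perm_polys5. degree f = d}"

end

theory Submission
  imports Defs
begin

text \<open>
  If \<open>f\<close> permutes the field, its values and their squares have the same power sums as the field
  elements, namely \<open>0\<close>; as in Hermite's criterion, this yields \<open>s\<^sub>4 = 0\<close> and
  \<open>s\<^sub>2\<^sup>2 + 2 s\<^sub>1 s\<^sub>3 = 0\<close>. Moreover \<open>f 4 - f 1 = 3 (s\<^sub>1 + s\<^sub>3)\<close>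
  cannot vanish. Conversely, under these conditions \<open>f\<close> is either linear or, up to affine maps,
  the cube of \<open>s\<^sub>3 x + 2 s\<^sub>2\<close>; and cubing is injective because \<open>x\<^sup>9 = x\<close>.
\<close>

text \<open>Translation by 1 permutes the ring, so summing \<open>x + 1\<close> instead of
  \<open>x\<close> changes nothing, yet it adds one 1 per element.\<close>

lemma of_nat_CARD_eq_0:
  assumes "finite (UNIV :: 'a::ring_1 set)"
  shows "of_nat CARD('a) = (0 :: 'a)"
proof -
  have "(\<Sum>x\<in>(UNIV :: 'a set). x + 1) = (\<Sum>x\<in>UNIV. x)"
    by (rule sum.reindex_bij_witness[of _ "\<lambda>x. x - 1" "\<lambda>x. x + 1"]) auto
  then show ?thesis
    by (simp add: sum.distrib)
qed

lemma poly_eq_pCons5: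
  assumes "degree f < 5"
  obtains s0 s1 s2 s3 s4 where "f = [:s0, s1, s2, s3, s4:]"
proof -
  have "f = [:coeff f 0, coeff f 1, coeff f 2, coeff f 3, coeff f 4:]"
    using assms by (auto intro!: poly_eqI simp: coeff_pCons coeff_eq_0 numeral_eq_Suc split: nat.split)
  then show thesis by (rule that)
qed

context
  assumes card5: "CARD('a::field) = 5"
begin

lemma five_eq_0: "(5 :: 'a) = 0"
  using of_nat_CARD_eq_0[where 'a = 'a] card5 by (simp add: card_ge_0_finite)

text \<open>Reduces congruences modulo 5 to identities valid in every commutative ring, with the
  multiple of 5 written out.\<close>

lemma eq_if_diff_eq_5_times:
  assumes "x - y = 5 * (z :: 'a)"
  shows "x = y"
  using assms five_eq_0 by simp

lemma two_neq_0: "(2 :: 'a) \<noteq> 0"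
proof
  assume "(2 :: 'a) = 0"
  moreover have "(1 :: 'a) = 5 - 2 * 2" by simp
  ultimately show False using five_eq_0 by simp
qed

lemma three_neq_0: "(3 :: 'a) \<noteq> 0"
proof
  assume "(3 :: 'a) = 0"
  moreover have "(1 :: 'a) = 2 * 3 - 5" by simp
  ultimately show False using five_eq_0 by simp
qed

lemma four_neq_0: "(4 :: 'a) \<noteq> 0"
  using two_neq_0 by (metis mult_eq_0_iff mult_2 numeral_Bit0)

lemma distinct5: "distinct [0, 1, 2, 3, 4 :: 'a]"
proof -
  have "(1 :: 'a) \<noteq> 2" "(1 :: 'a) \<noteq> 3" "(1 :: 'a) \<noteq> 4" "(2 :: 'a) \<noteq> 3" "(2 :: 'a) \<noteq> 4" "(3 :: 'a) \<noteq> 4"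
    using two_neq_0 three_neq_0 right_minus_eq[of "2 :: 'a" 1] right_minus_eq[of "3 :: 'a" 1]
      right_minus_eq[of "4 :: 'a" 1] right_minus_eq[of "3 :: 'a" 2] right_minus_eq[of "4 :: 'a" 2]
      right_minus_eq[of "4 :: 'a" 3]
    by auto
  then show ?thesis
    using two_neq_0 three_neq_0 four_neq_0 by auto
qed

lemma UNIV5: "(UNIV :: 'a set) = set [0, 1, 2, 3, 4]"
proof (rule card_subset_eq[symmetric])
  show "finite (UNIV :: 'a set)"
    using card5 by (simp add: card_ge_0_finite)
  show "card (set [0, 1, 2, 3, 4 :: 'a]) = CARD('a)"
    using distinct_card[OF distinct5] card5 by simp
qed simp

lemma sum_UNIV5: "sum g (UNIV :: 'a set) = g 0 + g 1 + g 2 + g 3 + (g 4 :: 'b::comm_monoid_add)"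
proof -
  have "sum g UNIV = sum_list (map g [0, 1, 2, 3, 4])"
    using sum.distinct_set_conv_list[OF distinct5] UNIV5 by metis
  then show ?thesis by (simp add: add.assoc)
qed

lemma pow4_eq_1_iff: "x ^ 4 = 1 \<longleftrightarrow> x \<noteq> (0 :: 'a)"
proof
  assume "x \<noteq> 0"
  moreover have "x = 0 \<or> x = 1 \<or> x = 2 \<or> x = 3 \<or> x = 4"
    using UNIV5 by (metis UNIV_I empty_iff empty_set insert_iff list.simps(15))
  moreover have "(2 :: 'a) ^ 4 = 1"
    by (rule eq_if_diff_eq_5_times[of _ _ 3]) simp
  moreover have "(3 :: 'a) ^ 4 = 1"
    by (rule eq_if_diff_eq_5_times[of _ _ 16]) simp
  moreover have "(4 :: 'a) ^ 4 = 1"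
    by (rule eq_if_diff_eq_5_times[of _ _ 51]) simp
  ultimately show "x ^ 4 = 1" by auto
qed auto

lemma inj_cube: "inj (\<lambda>x :: 'a. x ^ 3)"
proof (rule injI)
  fix x y :: 'a
  assume "x ^ 3 = y ^ 3"
  moreover have "(z ^ 3) ^ 3 = z" for z :: 'a
  proof (cases "z = 0")
    case False
    then have "z ^ 4 = 1" by (simp add: pow4_eq_1_iff)
    then show ?thesis by algebra
  qed simp
  ultimately show "x = y" by metis
qed

lemma bij_poly_iff:
  "bij (poly [:s0, s1, s2, s3, s4 :: 'a:]) \<longleftrightarrow> s4 = 0 \<and> s1 + s3 \<noteq> 0 \<and> s2 ^ 2 = 3 * s1 * s3"
  (is "bij ?f \<longleftrightarrow> _")
proof
  assume bij: "bij ?f"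
  have "sum ?f UNIV = (\<Sum>x\<in>UNIV. x)"
    using bij by (rule sum.reindex_bij_betw)
  \<comment> \<open>The coefficients are the integer power sums of 0, ..., 4 for exponents 0 to 4.
    Only 354 = 5 * 71 - 1 is not divisible by 5, which isolates \<open>s4\<close>.\<close>
  then have sum1: "5 * s0 + 10 * s1 + 30 * s2 + 100 * s3 + 354 * s4 - 10 = 0"
    unfolding sum_UNIV5 by (simp add: algebra_simps)
  have "s4 - 0 = 5 * (71 * s4 + 20 * s3 + 6 * s2 + 2 * s1 + s0 - 2)
      - (5 * s0 + 10 * s1 + 30 * s2 + 100 * s3 + 354 * s4 - 10)"
    by algebra
  then have s4: "s4 = 0"
    unfolding sum1 diff_0_right[of "5 * z" for z] by (rule eq_if_diff_eq_5_times)
  have "(\<Sum>x\<in>UNIV. ?f x ^ 2) = (\<Sum>x\<in>UNIV. x ^ 2)"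
    using bij by (rule sum.reindex_bij_betw)
  \<comment> \<open>The power sums for exponents 5 and 6 are 1300 and 4890, so again only the
    coefficient of \<open>x ^ 4\<close> in the square, \<open>s2 ^ 2 + 2 * s1 * s3\<close>, survives
    modulo 5.\<close>
  then have sum2: "5 * s0 ^ 2 + 20 * s0 * s1 + 60 * s0 * s2 + 200 * s0 * s3 + 30 * s1 ^ 2
      + 200 * s1 * s2 + 354 * (s2 ^ 2 + 2 * s1 * s3) + 2600 * s2 * s3 + 4890 * s3 ^ 2 - 30 = 0"
    unfolding sum_UNIV5 s4 by (simp add: algebra_simps power2_eq_square)
  \<comment> \<open>The extra \<open>- s1 * s3\<close> in the bracket turns 2 into -3.\<close>
  have "s2 ^ 2 - 3 * s1 * s3 =
      5 * (71 * (s2 ^ 2 + 2 * s1 * s3) - s1 * s3 + s0 ^ 2 + 4 * s0 * s1 + 12 * s0 * s2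
        + 40 * s0 * s3 + 6 * s1 ^ 2 + 40 * s1 * s2 + 520 * s2 * s3 + 978 * s3 ^ 2 - 6)
      - (5 * s0 ^ 2 + 20 * s0 * s1 + 60 * s0 * s2 + 200 * s0 * s3 + 30 * s1 ^ 2
        + 200 * s1 * s2 + 354 * (s2 ^ 2 + 2 * s1 * s3) + 2600 * s2 * s3 + 4890 * s3 ^ 2 - 30)"
    by algebra
  then have s2: "s2 ^ 2 = 3 * s1 * s3"
    unfolding sum2 diff_0_right by (rule eq_if_diff_eq_5_times)
  have "s1 + s3 \<noteq> 0"
  proof
    assume "s1 + s3 = 0"
    \<comment> \<open>The points are 1 and 4 = -1: their squares agree, and each equals its own
      cube, so the values differ only through \<open>s1 + s3\<close>.\<close>
    then have "?f 1 - ?f 4 = 5 * (- 3 * s2 - 12 * s3)"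
      using s4 by simp algebra
    then have "?f 1 = ?f 4"
      by (rule eq_if_diff_eq_5_times)
    then have "(1 :: 'a) = 4"
      using bij_is_inj[OF bij] by (rule injD[rotated])
    then show False
      using distinct5 by simp
  qed
  with s4 s2 show "s4 = 0 \<and> s1 + s3 \<noteq> 0 \<and> s2 ^ 2 = 3 * s1 * s3"
    by simp
next
  assume s: "s4 = 0 \<and> s1 + s3 \<noteq> 0 \<and> s2 ^ 2 = 3 * s1 * s3"
  have "inj ?f"
  proof (cases "s3 = 0")
    case True
    with s show ?thesis by (auto intro!: injI)
  next
    case False
    \<comment> \<open>Completing the cube, with 2 as the inverse of 3. The linear term is 12 *
      \<open>s3 * s2 ^ 2 * x\<close> = 36 * \<open>s1 * s3 ^ 2 * x\<close>, and 36 - 1 = 5 * 7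
      explains the 7.\<close>
    have cube: "(s3 * x + 2 * s2) ^ 3 = s3 ^ 2 * (?f x - s0) + 3 * s2 ^ 3" for x
      by (rule eq_if_diff_eq_5_times[of _ _ "s3 ^ 2 * s2 * x ^ 2 + 7 * s1 * s3 ^ 2 * x + s2 ^ 3"])
        (use s in simp, algebra)
    show ?thesis
    proof (rule injI)
      fix x y
      assume "?f x = ?f y"
      then have "(s3 * x + 2 * s2) ^ 3 = (s3 * y + 2 * s2) ^ 3"
        by (simp only: cube)
      then have "s3 * x + 2 * s2 = s3 * y + 2 * s2"
        by (rule injD[OF inj_cube])
      with False show "x = y" by simp
    qed
  qed
  moreover have "finite (UNIV :: 'a set)"
    using card5 by (simp add: card_ge_0_finite)
  ultimately show "bij ?f"
    unfolding bij_def using finite_UNIV_inj_surj by blast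
qed

text \<open>If \<open>s\<^sub>1 = - s\<^sub>3\<close>, then \<open>s\<^sub>2\<^sup>2 = 2 s\<^sub>3\<^sup>2\<close>, and \<open>2\<close> is a nonsquare modulo \<open>5\<close>.\<close>

lemma sum_neq_0:
  assumes "s3 \<noteq> (0 :: 'a)" and "s2 ^ 2 = 3 * s1 * s3"
  shows "s1 + s3 \<noteq> 0"
proof
  assume "s1 + s3 = 0"
  with assms(2) have "s2 ^ 2 - 2 * s3 ^ 2 = 5 * (- (s3 ^ 2))"
    by algebra
  then have "s2 ^ 2 = 2 * s3 ^ 2"
    by (rule eq_if_diff_eq_5_times)
  \<comment> \<open>Squaring turns the factor 2 into 4 = -1, whereas fourth powers are only 0 or
    1.\<close>
  then have "s2 ^ 4 - - (s3 ^ 4) = 5 * s3 ^ 4"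
    by algebra
  then have "s2 ^ 4 = - (s3 ^ 4)"
    by (rule eq_if_diff_eq_5_times)
  moreover have "s3 ^ 4 = 1"
    using assms(1) by (simp add: pow4_eq_1_iff)
  moreover have "s2 ^ 4 = 0 \<or> s2 ^ 4 = 1"
    using pow4_eq_1_iff[of s2] by auto
  ultimately show False
    using two_neq_0 by (auto simp: eq_neg_iff_add_eq_0)
qed

lemma perm_polys5_eq:
  "(perm_polys5 :: 'a poly set) =
     {[:s0, s1, s2, s3:] | s0 s1 s2 s3. (s1 + s3) ^ 4 = 1 \<and> s2 ^ 2 = 3 * s1 * s3}"
proof -
  have "\<exists>s0 s1 s2 s3. f = [:s0, s1, s2, s3:] \<and> s1 + s3 \<noteq> 0 \<and> s2 ^ 2 = 3 * s1 * s3"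
    if deg: "degree f < 5" and bij: "bij (poly f)" for f :: "'a poly"
  proof -
    obtain s0 s1 s2 s3 s4 where f: "f = [:s0, s1, s2, s3, s4:]"
      using deg by (rule poly_eq_pCons5)
    have "s4 = 0 \<and> s1 + s3 \<noteq> 0 \<and> s2 ^ 2 = 3 * s1 * s3"
      using bij unfolding f bij_poly_iff .
    with f show ?thesis by auto
  qed
  moreover have "degree [:s0, s1, s2, s3:] < 5" for s0 s1 s2 s3 :: 'a
    by simp
  moreover have "bij (poly [:s0, s1, s2, s3:])"
    if "s1 + s3 \<noteq> 0" "s2 ^ 2 = 3 * s1 * s3" for s0 s1 s2 s3 :: 'a
    using bij_poly_iff[of s0 s1 s2 s3 0] that by simp
  ultimately show ?thesis
    unfolding perm_polys5_def pow4_eq_1_iff by blast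
qed

lemma perm_polys5_deg_1_eq:
  "(perm_polys5_deg 1 :: 'a poly set) = {[:s0, s1:] | s0 s1. s1 ^ 4 = 1}"
proof -
  have deg: "degree [:s0, s1, s2, s3:] = 1 \<longleftrightarrow> s1 \<noteq> 0 \<and> s2 = 0 \<and> s3 = 0"
    for s0 s1 s2 s3 :: 'a
    by simp
  show ?thesis
  proof (intro set_eqI iffI)
    fix f :: "'a poly"
    assume "f \<in> perm_polys5_deg 1"
    then obtain s0 s1 s2 s3 where "f = [:s0, s1, s2, s3:]" "s1 \<noteq> 0 \<and> s2 = 0 \<and> s3 = 0"
      unfolding perm_polys5_deg_def perm_polys5_eq using deg by blast
    then have "f = [:s0, s1:]" "s1 ^ 4 = 1"
      by (simp_all add: pow4_eq_1_iff)
    then show "f \<in> {[:s0, s1:] | s0 s1. s1 ^ 4 = 1}"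
      by blast
  next
    fix f :: "'a poly"
    assume "f \<in> {[:s0, s1:] | s0 s1. s1 ^ 4 = 1}"
    then obtain s0 s1 where "f = [:s0, s1:]" "s1 ^ 4 = 1"
      by blast
    then have f: "f = [:s0, s1, 0, 0:]" "(s1 + 0) ^ 4 = 1" "0 ^ 2 = 3 * s1 * 0"
      and "degree f = 1"
      by (auto simp: pow4_eq_1_iff)
    from f have "f \<in> perm_polys5"
      unfolding perm_polys5_eq by blast
    with \<open>degree f = 1\<close> show "f \<in> perm_polys5_deg 1"
      unfolding perm_polys5_deg_def by simp
  qed
qed

lemma perm_polys5_deg_3_eq:
  "(perm_polys5_deg 3 :: 'a poly set) =
     {[:s0, s1, s2, s3:] | s0 s1 s2 s3. s3 ^ 4 = 1 \<and> s2 ^ 2 = 3 * s1 * s3}"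
proof -
  have deg: "degree [:s0, s1, s2, s3:] = 3 \<longleftrightarrow> s3 \<noteq> 0" for s0 s1 s2 s3 :: 'a
    by simp
  show ?thesis
    \<comment> \<open>By \<open>sum_neq_0\<close>, the condition on \<open>s1 + s3\<close> is
      automatic once \<open>s3\<close> is nonzero.\<close>
    unfolding perm_polys5_deg_def perm_polys5_eq pow4_eq_1_iff
    using deg sum_neq_0 by blast
qed

text \<open>Without a cubic term the quadratic relation forces \<open>s2 = 0\<close>, and then
  \<open>s1\<close> is nonzero; this excludes degrees 0 and 2.\<close>

lemma degree_perm_polys5:
  assumes "f \<in> (perm_polys5 :: 'a poly set)"
  shows "degree f = 1 \<or> degree f = 3"
proof -
  obtain s0 s1 s2 s3 where f: "f = [:s0, s1, s2, s3:]"
    and s: "s1 + s3 \<noteq> 0" "s2 ^ 2 = 3 * s1 * s3"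
    using assms unfolding perm_polys5_eq pow4_eq_1_iff by blast
  show ?thesis
  proof (cases "s3 = 0")
    case True
    with s have "s1 \<noteq> 0" "s2 = 0" by simp_all
    with f True show ?thesis by simp
  next
    case False
    with f show ?thesis by simp
  qed
qed

end

theorem proposition3p2:
  assumes "CARD('a::field) = 5"
  shows
    "(perm_polys5 :: 'a poly set) = perm_polys5_deg 1 \<union> perm_polys5_deg 3 \<and>
     (perm_polys5_deg 1 :: 'a poly set) \<inter> perm_polys5_deg 3 = {} \<and>
     (perm_polys5 :: 'a poly set) =
       {[:s0, s1, s2, s3:] | s0 s1 s2 s3. (s1 + s3) ^ 4 = 1 \<and> s2 ^ 2 = 3 * s1 * s3} \<and>
     (perm_polys5_deg 1 :: 'a poly set) = {[:s0, s1:] | s0 s1. s1 ^ 4 = 1} \<and>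
     (perm_polys5_deg 3 :: 'a poly set) =
       {[:s0, s1, s2, s3:] | s0 s1 s2 s3. s3 ^ 4 = 1 \<and> s2 ^ 2 = 3 * s1 * s3}"
proof (intro conjI)
  show "(perm_polys5 :: 'a poly set) = perm_polys5_deg 1 \<union> perm_polys5_deg 3"
    using degree_perm_polys5[OF assms] by (auto simp: perm_polys5_deg_def)
  show "(perm_polys5_deg 1 :: 'a poly set) \<inter> perm_polys5_deg 3 = {}"
    by (auto simp: perm_polys5_deg_def)
qed (fact perm_polys5_eq[OF assms] perm_polys5_deg_1_eq[OF assms] perm_polys5_deg_3_eq[OF assms])+

end
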